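(* Let $V$ be a finite set, let $m:V\to[0,1]$ be a score function, and let $P_f$ and $P_c$ be two partitions of $V$ such that $P_f$ refines $P_c$. For any partition $P$ of $V$, define $$\mathrm{Env}_P(m)(v)=\max_{u\in V:\,P(u)=P(v)} m(u)\qquad (v\in V).$$ Then for every $v\in V$, $$\mathrm{Env}_{P_f}(m)(v)\le \mathrm{Env}_{P_c}(m)(v).$$
   Context: For a partition $P$ of $V$ and $v\in V$, $P(v)$ denotes the cell of $P$ containing $v$. A partition $P_f$ refines $P_c$ if every cell of $P_f$ is contained in a cell of $P_c$. *)

theory Defs
  imports Complex_Main "HOL-Library.Disjoint_Sets" "HOL-Library.FuncSet"
begin

(* Meaningful when P is a partition of a set containing v: the cell is then unique. *)
definition cell_of :: "'a set set \<Rightarrow> 'a \<Rightarrow> 'a set"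
  where "cell_of P v = (THE C. C \<in> P \<and> v \<in> C)"

(* Only used for finite V and v in V, where the maximum is over a finite nonempty set. *)
definition Env :: "'a set \<Rightarrow> 'a set set \<Rightarrow> ('a \<Rightarrow> real) \<Rightarrow> 'a \<Rightarrow> real"
  where "Env V P m v = Max (m ` {u \<in> V. cell_of P u = cell_of P v})"

end

theory Submission
  imports Defs
begin

text \<open>Coarsening a partition can only enlarge the set over which the envelope at a point takes
  its maximum: points that share a fine cell also share a coarse cell
  (\<open>refines_cell_of_eq\<close>). The claim is then monotonicity of the maximum under inclusion
  of finite nonempty sets. \<open>cell_of_eq\<close> and \<open>cell_of_mem\<close> connect the
  definite description \<open>cell_of\<close> with actual cells.\<close>

text \<open>Disjointness of the cells gives uniqueness, so exhibiting one cell through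
  \<open>v\<close> evaluates the description.\<close>

lemma cell_of_eq:
  assumes "partition_on V P" "C \<in> P" "v \<in> C"
  shows "cell_of P v = C"
  unfolding cell_of_def
proof (rule the_equality)
  show "C \<in> P \<and> v \<in> C" using assms by simp
  show "D = C" if "D \<in> P \<and> v \<in> D" for D
    using that assms disjointD[OF partition_onD2[OF assms(1)], of D C] by blast
qed

lemma cell_of_mem:
  assumes "partition_on V P" "v \<in> V"
  shows "cell_of P v \<in> P" "v \<in> cell_of P v"
proof -
  obtain C where "C \<in> P" "v \<in> C"
    using assms partition_onD1 by blast
  with cell_of_eq[OF assms(1) this] show "cell_of P v \<in> P" "v \<in> cell_of P v"
    by simp_all
qed

text \<open>The common fine cell of \<open>u\<close> and \<open>v\<close> lies inside a single
  coarse cell \<open>D\<close>, which must then be the \<open>Q\<close>-cell of both points.\<close>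

lemma refines_cell_of_eq:
  assumes "refines V P Q" "u \<in> V" "v \<in> V" "cell_of P u = cell_of P v"
  shows "cell_of Q u = cell_of Q v"
proof -
  have P: "partition_on V P" and Q: "partition_on V Q"
    using assms(1) by (auto simp: refines_def)
  obtain D where D: "D \<in> Q" "cell_of P v \<subseteq> D"
    using assms(1) cell_of_mem(1)[OF P assms(3)] by (auto simp: refines_def)
  have "u \<in> D" "v \<in> D"
    using D(2) cell_of_mem(2)[OF P] assms(2-4) by auto
  then show ?thesis
    using cell_of_eq[OF Q D(1)] by simp
qed

theorem proposition3:
  fixes V :: "'a set" and m :: "'a \<Rightarrow> real" and P\<^sub>f P\<^sub>c :: "'a set set"
  assumes "finite V"
    and "m \<in> V \<rightarrow> {0..1}"
    and "partition_on V P\<^sub>f"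
    and "partition_on V P\<^sub>c"
    and "refines V P\<^sub>f P\<^sub>c"
  shows "\<forall>v\<in>V. Env V P\<^sub>f m v \<le> Env V P\<^sub>c m v"
proof
  fix v assume "v \<in> V"
  show "Env V P\<^sub>f m v \<le> Env V P\<^sub>c m v"
    unfolding Env_def
  proof (rule Max_mono)
    show "m ` {u \<in> V. cell_of P\<^sub>f u = cell_of P\<^sub>f v} \<subseteq> m ` {u \<in> V. cell_of P\<^sub>c u = cell_of P\<^sub>c v}"
      using refines_cell_of_eq[OF assms(5) _ \<open>v \<in> V\<close>] by blast
    \<comment> \<open>The point \<open>v\<close> itself is a witness; \<open>Max\<close> is
      meaningful only on nonempty sets.\<close>
    show "m ` {u \<in> V. cell_of P\<^sub>f u = cell_of P\<^sub>f v} \<noteq> {}"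
      using \<open>v \<in> V\<close> by blast
    show "finite (m ` {u \<in> V. cell_of P\<^sub>c u = cell_of P\<^sub>c v})"
      using assms(1) by simp
  qed
qed

end
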